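(* Let $X$ be a compact metric space, let $\mu$ be a probability measure on the $\sigma$-algebra $\mathcal{B}$ of Borel subsets of $X$, and let $\mathcal{U}$ be a non-principal ultrafilter on $\mathbb{N}$. If $(f_n)_{n\in\mathbb{N}}$ is a $\mathcal{U}$-integrable sequence of real-valued functions on $X$, then the map $$[x_n] \in \widehat{X} \;\mapsto\; \mathcal{U}\text{-}\lim_n f_n(x_n)$$ is $\widehat\mu_{\mathcal{U}}$-integrable and satisfies $$\int_{\widehat X} \mathcal{U}\text{-}\lim_n f_n(x_n)\, d\widehat\mu_{\mathcal{U}}([x_n]) = \mathcal{U}\text{-}\lim_n \int_X f_n(x)\, d\mu(x).$$
   Context: $\mathcal{U}$-integrability: a sequence $(f_n)_{n\in\mathbb{N}}$ of $\mathcal{B}$-measurable functions $f_n:X\to\mathbb{R}$ is $\mathcal{U}$-integrable if (1) every $f_n$ is $\mu$-integrable; (2) $\mathcal{U}\text{-}\lim_n\int_X|f_n|\,d\mu$ is finite; (3) for every sequence $(B_n)$ in $\mathcal{B}$, $\mathcal{U}\text{-}\lim_n\mu(B_n)=0$ implies $\mathcal{U}\text{-}\lim_n\int_{B_n}|f_n|\,d\mu=0$. Ultralimits: a sequence $(a_n)$ in a compact Hausdorff space has $\mathcal{U}\text{-}\lim_n a_n=\ell$ if $\{n\in\mathbb{N} : a_n\in V\}\in\mathcal{U}$ for every neighbourhood $V$ of $\ell$; the limit exists and is unique. For real sequences the $\mathcal{U}$-limit is taken in $[-\infty,+\infty]$. Ultrapower: $\widehat X = X^{\mathbb{N}}/\sim$,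 where $(a_n)\sim(b_n)$ iff $\{n : a_n=b_n\}\in\mathcal{U}$; $[x_n]$ denotes the class of $(x_n)_{n\in\mathbb{N}}$. The value $\mathcal{U}\text{-}\lim_n f_n(x_n)$ does not depend on the representative of $[x_n]$. Ultrapower measure: for a sequence $(A_n)$ of subsets of $X$, the UP-set $\left(\prod_n A_n\right)/\sim$ is the set of all $[x_n]\in\widehat X$ with $\{n : x_n\in A_n\}\in\mathcal{U}$. Let $\widehat{\mathcal{B}}$ be the algebra of UP-sets with all $A_n\in\mathcal{B}$, and define $\widehat\mu_{\mathcal{U}}\left(\left(\prod_n A_n\right)/\sim\right)=\mathcal{U}\text{-}\lim_n\mu(A_n)$ (well defined and finitely additive; it satisfies the countable additivity compatibility condition on $\widehat{\mathcal{B}}$). Its Carathéodory extension, still denoted $\widehat\mu_{\mathcal{U}}$, is a complete probability measure on a $\sigma$-algebra $L(\widehat{\mathcal{B}})\supset\widehat{\mathcal{B}}$ (the sets measurable for the outer measure induced by $\widehat\mu_{\mathcal{U}}$ on $\widehat{\mathcal{B}}$). Measurability and integrability on $\widehat X$ refer to $(L(\widehat{\mathcal{B}}),\widehat\mu_{\mathcal{U}})$. *)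

theory Defs
  imports "HOL-Probability.Probability"
begin

section \<open>Ultrafilters and ultralimits\<close>

text \<open>A set \<open>S\<close> belongs to the ultrafilter \<open>U\<close> iff \<open>eventually (\<lambda>n. n \<in> S) U\<close>. The type of
  filters contains the improper filter \<^term>\<open>bot\<close>, which has to be excluded.\<close>

definition ultrafilter :: "'i filter \<Rightarrow> bool" where
  "ultrafilter U \<longleftrightarrow> U \<noteq> bot \<and> (\<forall>P. eventually P U \<or> eventually (\<lambda>i. \<not> P i) U)"

definition nonprincipal_ultrafilter :: "'i filter \<Rightarrow> bool" where
  "nonprincipal_ultrafilter U \<longleftrightarrow> ultrafilter U \<and> (\<nexists>S. U = principal S)"

text \<open>In a compact Hausdorff space the ultralimit along \<open>U\<close> is the library's \<^term>\<open>Lim U\<close>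
  (see \<open>tendsto_Lim_ultrafilter\<close> below). Ultralimits of real sequences are taken in
  \<open>[-\<infinity>, \<infinity>]\<close>.\<close>

abbreviation ulim :: "'i filter \<Rightarrow> ('i \<Rightarrow> real) \<Rightarrow> ereal" where
  "ulim U a \<equiv> Lim U (\<lambda>i. ereal (a i))"

definition U_integrable ::
    "nat filter \<Rightarrow> 'a measure \<Rightarrow> (nat \<Rightarrow> 'a \<Rightarrow> real) \<Rightarrow> bool" where
  "U_integrable U M f \<longleftrightarrow>
     (\<forall>n. f n \<in> borel_measurable M) \<and>
     (\<forall>n. integrable M (f n)) \<and>
     \<bar>ulim U (\<lambda>n. \<integral>x. \<bar>f n x\<bar> \<partial>M)\<bar> \<noteq> \<infinity> \<and>
     (\<forall>B. (\<forall>n. B n \<in> sets M) \<longrightarrow> ulim U (\<lambda>n. measure M (B n)) = 0 \<longrightarrow>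
        ulim U (\<lambda>n. set_lebesgue_integral M (B n) (\<lambda>x. \<bar>f n x\<bar>)) = 0)"


section \<open>The ultrapower and its measure\<close>

definition ultra_rel :: "nat filter \<Rightarrow> ((nat \<Rightarrow> 'a) \<times> (nat \<Rightarrow> 'a)) set" where
  "ultra_rel U = {(a, b). eventually (\<lambda>n. a n = b n) U}"

definition ultrapower :: "nat filter \<Rightarrow> (nat \<Rightarrow> 'a) set set" where
  "ultrapower U = UNIV // ultra_rel U"

definition uclass :: "nat filter \<Rightarrow> (nat \<Rightarrow> 'a) \<Rightarrow> (nat \<Rightarrow> 'a) set" where
  "uclass U x = ultra_rel U `` {x}"

definition UP_set :: "nat filter \<Rightarrow> (nat \<Rightarrow> 'a set) \<Rightarrow> (nat \<Rightarrow> 'a) set set" where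
  "UP_set U A = {uclass U x |x. eventually (\<lambda>n. x n \<in> A n) U}"

definition UP_algebra :: "nat filter \<Rightarrow> 'a measure \<Rightarrow> (nat \<Rightarrow> 'a) set set set" where
  "UP_algebra U M = {UP_set U A |A. \<forall>n. A n \<in> sets M}"

text \<open>The value does not depend on the chosen representation of the UP-set, see
  \<open>UP_premeasure_UP_set\<close> below.\<close>

definition UP_premeasure :: "nat filter \<Rightarrow> 'a measure \<Rightarrow> (nat \<Rightarrow> 'a) set set \<Rightarrow> ennreal" where
  "UP_premeasure U M S =
     (THE r. \<exists>A. (\<forall>n. A n \<in> sets M) \<and> S = UP_set U A \<and> r = Lim U (\<lambda>n. emeasure M (A n)))"

text \<open>The Caratheodory extension to all sets measurable for the induced outer measure.\<close>

definition UP_sets :: "nat filter \<Rightarrow> 'a measure \<Rightarrow> (nat \<Rightarrow> 'a) set set set" where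
  "UP_sets U M = lambda_system (ultrapower U) (Pow (ultrapower U))
     (outer_measure (UP_algebra U M) (UP_premeasure U M))"

definition UP_measure :: "nat filter \<Rightarrow> 'a measure \<Rightarrow> (nat \<Rightarrow> 'a) set measure" where
  "UP_measure U M = measure_of (ultrapower U) (UP_sets U M)
     (outer_measure (UP_algebra U M) (UP_premeasure U M))"

text \<open>The function \<open>[x\<^sub>n] \<mapsto> U-lim f\<^sub>n(x\<^sub>n)\<close>, see \<open>ulim_fun_uclass\<close> below.\<close>

definition ulim_fun :: "nat filter \<Rightarrow> (nat \<Rightarrow> 'a \<Rightarrow> real) \<Rightarrow> (nat \<Rightarrow> 'a) set \<Rightarrow> ereal" where
  "ulim_fun U f c = the_elem ((\<lambda>x. ulim U (\<lambda>n. f n (x n))) ` c)"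


section \<open>Integration of extended-real-valued functions\<close>

text \<open>The Bochner integral of the library requires values in a Banach space, whereas an ultralimit
  may be infinite at some points. The coercion \<^term>\<open>e2ennreal\<close> maps negative numbers to 0,
  so the terms below are the integrals of the positive and of the negative part.\<close>

definition ereal_integrable :: "'a measure \<Rightarrow> ('a \<Rightarrow> ereal) \<Rightarrow> bool" where
  "ereal_integrable M g \<longleftrightarrow>
     g \<in> borel_measurable M \<and> (\<integral>\<^sup>+x. e2ennreal \<bar>g x\<bar> \<partial>M) < \<infinity>"

definition ereal_integral :: "'a measure \<Rightarrow> ('a \<Rightarrow> ereal) \<Rightarrow> ereal" where
  "ereal_integral M g =
     enn2ereal (\<integral>\<^sup>+x. e2ennreal (g x) \<partial>M) - enn2ereal (\<integral>\<^sup>+x. e2ennreal (- g x) \<partial>M)"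


section \<open>Well-definedness\<close>

lemma tendsto_Lim_ultrafilter:
  fixes a :: "'i \<Rightarrow> 'b::t2_space"
  assumes U: "ultrafilter U" and cpt: "compact (UNIV :: 'b set)"
  shows "(a \<longlongrightarrow> Lim U a) U"
proof -
  have nb: "U \<noteq> bot" using U by (simp add: ultrafilter_def)
  have "\<exists>l. (a \<longlongrightarrow> l) U"
  proof (rule ccontr)
    assume "\<nexists>l. (a \<longlongrightarrow> l) U"
    then have "\<forall>l. \<exists>S. open S \<and> l \<in> S \<and> \<not> eventually (\<lambda>i. a i \<in> S) U"
      unfolding tendsto_def by blast
    then obtain S where S: "\<And>l. open (S l)" "\<And>l. l \<in> S l"
        "\<And>l. \<not> eventually (\<lambda>i. a i \<in> S l) U"
      by metis
    have cover: "UNIV \<subseteq> (\<Union>l\<in>UNIV. S l)" using S(2) by blast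
    obtain C where C: "C \<subseteq> UNIV" "finite C" "UNIV \<subseteq> (\<Union>l\<in>C. S l)"
      by (rule compactE_image[OF cpt _ cover]) (rule S(1))
    have "eventually (\<lambda>i. a i \<notin> S l) U" for l
      using U S(3)[of l] by (auto simp: ultrafilter_def)
    then have "eventually (\<lambda>i. \<forall>l\<in>C. a i \<notin> S l) U"
      using C(2) by (simp add: eventually_ball_finite)
    then have "eventually (\<lambda>i. False) U"
      by (rule eventually_mono) (use C(3) in blast)
    then show False using nb by (simp add: eventually_False)
  qed
  then obtain l where l: "(a \<longlongrightarrow> l) U" ..
  then show ?thesis by (simp add: tendsto_Lim[OF nb l])
qed

lemma Lim_cong_eventually:
  assumes "eventually (\<lambda>i. a i = b i) U"
  shows "Lim U a = Lim U b"
proof -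
  have "(a \<longlongrightarrow> l) U \<longleftrightarrow> (b \<longlongrightarrow> l) U" for l
    using assms by (rule tendsto_cong)
  then show ?thesis by (simp add: t2_space_class.Lim_def)
qed

lemma equiv_ultra_rel: "equiv UNIV (ultra_rel U)"
proof (rule equivI)
  show "ultra_rel U \<subseteq> UNIV \<times> UNIV" by simp
  show "refl (ultra_rel U)" by (simp add: ultra_rel_def refl_on_def)
  show "sym (ultra_rel U)" by (auto simp: ultra_rel_def sym_def eq_commute)
  show "trans (ultra_rel U)"
    unfolding ultra_rel_def trans_def by (auto elim: eventually_elim2)
qed

lemma mem_uclass: "y \<in> uclass U x \<longleftrightarrow> eventually (\<lambda>n. x n = y n) U"
  by (simp add: uclass_def ultra_rel_def)

lemma uclass_eq_iff: "uclass U x = uclass U y \<longleftrightarrow> eventually (\<lambda>n. x n = y n) U"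
  unfolding uclass_def using eq_equiv_class_iff[OF equiv_ultra_rel, of x y U]
  by (simp add: ultra_rel_def)

lemma ultrapower_eq: "ultrapower U = range (uclass U)"
  by (auto simp: ultrapower_def quotient_def uclass_def)

lemma ulim_fun_uclass: "ulim_fun U f (uclass U x) = ulim U (\<lambda>n. f n (x n))"
proof -
  have "ulim U (\<lambda>n. f n (y n)) = ulim U (\<lambda>n. f n (x n))" if "y \<in> uclass U x" for y
    by (rule Lim_cong_eventually)
       (use that in \<open>auto simp: mem_uclass elim: eventually_mono\<close>)
  then have "(\<lambda>y. ulim U (\<lambda>n. f n (y n))) ` uclass U x = (\<lambda>_. ulim U (\<lambda>n. f n (x n))) ` uclass U x"
    by (rule image_cong[OF refl])
  moreover have "uclass U x \<noteq> {}" by (auto simp: set_eq_iff mem_uclass intro!: exI[of _ x])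
  ultimately show ?thesis by (simp add: ulim_fun_def image_constant_conv)
qed

lemma uclass_in_UP_set: "uclass U x \<in> UP_set U A \<longleftrightarrow> eventually (\<lambda>n. x n \<in> A n) U"
proof
  assume "uclass U x \<in> UP_set U A"
  then obtain y where "eventually (\<lambda>n. x n = y n) U" "eventually (\<lambda>n. y n \<in> A n) U"
    by (auto simp: UP_set_def uclass_eq_iff)
  then show "eventually (\<lambda>n. x n \<in> A n) U"
    by (rule eventually_elim2) simp
qed (auto simp: UP_set_def)

lemma UP_set_subset: "UP_set U A \<subseteq> ultrapower U"
  by (auto simp: UP_set_def ultrapower_eq)

lemma UP_set_mono_iff:
  assumes U: "ultrafilter U"
  shows "UP_set U A \<subseteq> UP_set U B \<longleftrightarrow> eventually (\<lambda>n. A n \<subseteq> B n) U"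
proof
  assume sub: "UP_set U A \<subseteq> UP_set U B"
  show "eventually (\<lambda>n. A n \<subseteq> B n) U"
  proof (rule ccontr)
    assume "\<not> eventually (\<lambda>n. A n \<subseteq> B n) U"
    then have ev: "eventually (\<lambda>n. \<not> A n \<subseteq> B n) U"
      using U by (auto simp: ultrafilter_def)
    define x where "x = (\<lambda>n. SOME y. y \<in> A n \<and> y \<notin> B n)"
    have x: "x n \<in> A n \<and> x n \<notin> B n" if "\<not> A n \<subseteq> B n" for n
      unfolding x_def by (rule someI_ex) (use that in blast)
    have "eventually (\<lambda>n. x n \<in> A n) U"
      using ev by (rule eventually_mono) (use x in blast)
    then have "eventually (\<lambda>n. x n \<in> B n) U"
      using sub uclass_in_UP_set by blast
    with ev have "eventually (\<lambda>n. False) U"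
      by (rule eventually_elim2) (use x in blast)
    then show False using U by (simp add: ultrafilter_def eventually_False)
  qed
next
  assume ev: "eventually (\<lambda>n. A n \<subseteq> B n) U"
  have "eventually (\<lambda>n. x n \<in> B n) U" if "eventually (\<lambda>n. x n \<in> A n) U" for x
    using ev that by (rule eventually_elim2) blast
  then show "UP_set U A \<subseteq> UP_set U B"
    unfolding UP_set_def by blast
qed

lemma UP_premeasure_UP_set:
  assumes U: "ultrafilter U" and A: "\<And>n. A n \<in> sets M"
  shows "UP_premeasure U M (UP_set U A) = Lim U (\<lambda>n. emeasure M (A n))"
  unfolding UP_premeasure_def
proof (rule the_equality)
  fix r
  assume "\<exists>A'. (\<forall>n. A' n \<in> sets M) \<and> UP_set U A = UP_set U A' \<and>
    r = Lim U (\<lambda>n. emeasure M (A' n))"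
  then obtain A' where A': "UP_set U A = UP_set U A'" "r = Lim U (\<lambda>n. emeasure M (A' n))"
    by blast
  have "eventually (\<lambda>n. A n \<subseteq> A' n) U" "eventually (\<lambda>n. A' n \<subseteq> A n) U"
    using A'(1) by (simp_all flip: UP_set_mono_iff[OF U])
  then have "eventually (\<lambda>n. emeasure M (A' n) = emeasure M (A n)) U"
    by (rule eventually_elim2) (metis subset_antisym)
  then show "r = Lim U (\<lambda>n. emeasure M (A n))"
    unfolding A'(2) by (rule Lim_cong_eventually)
qed (use A in blast)

lemma UP_set_Un:
  assumes U: "ultrafilter U"
  shows "UP_set U A \<union> UP_set U B = UP_set U (\<lambda>n. A n \<union> B n)"
proof -
  have "eventually (\<lambda>n. x n \<in> A n) U \<or> eventually (\<lambda>n. x n \<in> B n) U"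
    if ev: "eventually (\<lambda>n. x n \<in> A n \<union> B n) U" for x
  proof (rule disjCI)
    assume "\<not> eventually (\<lambda>n. x n \<in> B n) U"
    then have "eventually (\<lambda>n. x n \<notin> B n) U" using U by (auto simp: ultrafilter_def)
    with ev show "eventually (\<lambda>n. x n \<in> A n) U" by (rule eventually_elim2) blast
  qed
  moreover have "eventually (\<lambda>n. x n \<in> A n \<union> B n) U"
    if "eventually (\<lambda>n. x n \<in> A n) U \<or> eventually (\<lambda>n. x n \<in> B n) U" for x
    using that by (auto elim: eventually_mono)
  ultimately show ?thesis
    unfolding UP_set_def by blast
qed

lemma UP_set_Diff:
  assumes U: "ultrafilter U"
  shows "UP_set U A - UP_set U B = UP_set U (\<lambda>n. A n - B n)"
proof (intro set_eqI)
  fix c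
  have *: "eventually (\<lambda>n. x n \<notin> B n) U \<longleftrightarrow> \<not> eventually (\<lambda>n. x n \<in> B n) U" for x
  proof
    assume 1: "eventually (\<lambda>n. x n \<notin> B n) U"
    show "\<not> eventually (\<lambda>n. x n \<in> B n) U"
    proof
      assume "eventually (\<lambda>n. x n \<in> B n) U"
      with 1 have "eventually (\<lambda>n. False) U" by (rule eventually_elim2) blast
      then show False using U by (simp add: ultrafilter_def eventually_False)
    qed
  qed (use U in \<open>auto simp: ultrafilter_def\<close>)
  show "c \<in> UP_set U A - UP_set U B \<longleftrightarrow> c \<in> UP_set U (\<lambda>n. A n - B n)"
  proof (cases "c \<in> range (uclass U)")
    case True
    then show ?thesis by (auto simp: uclass_in_UP_set eventually_conj_iff *)
  next
    case False
    then show ?thesis by (auto simp: UP_set_def)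
  qed
qed

lemma algebra_UP_algebra:
  fixes M :: "'a measure"
  assumes U: "ultrafilter U" and M: "space M = UNIV"
  shows "algebra (ultrapower U) (UP_algebra U M)"
  unfolding algebra_iff_Un
proof (intro conjI ballI)
  show "UP_algebra U M \<subseteq> Pow (ultrapower U)"
    using UP_set_subset by (fastforce simp: UP_algebra_def)
  have "UP_set U (\<lambda>_. {}) = {}"
    using U by (auto simp: UP_set_def ultrafilter_def eventually_False)
  then show "{} \<in> UP_algebra U M"
    unfolding UP_algebra_def
    by (intro CollectI exI[of _ "\<lambda>_. {}"]) auto
next
  fix S assume "S \<in> UP_algebra U M"
  then obtain A where A: "S = UP_set U A" "\<And>n. A n \<in> sets M"
    by (auto simp: UP_algebra_def)
  have "ultrapower U = UP_set U (\<lambda>_. UNIV :: 'a set)"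
    by (auto simp: UP_set_def ultrapower_eq)
  then have "ultrapower U - S = UP_set U (\<lambda>n. UNIV - A n)"
    using UP_set_Diff[OF U, of "\<lambda>_. UNIV" A] A(1) by simp
  moreover have "UNIV - A n \<in> sets M" for n
    using sets.compl_sets[OF A(2)[of n]] M by simp
  ultimately show "ultrapower U - S \<in> UP_algebra U M"
    unfolding UP_algebra_def by (intro CollectI exI[of _ "\<lambda>n. UNIV - A n"]) simp
next
  fix S T assume "S \<in> UP_algebra U M" and "T \<in> UP_algebra U M"
  then obtain A B where A: "S = UP_set U A" "\<And>n. A n \<in> sets M"
      and B: "T = UP_set U B" "\<And>n. B n \<in> sets M"
    unfolding UP_algebra_def by blast
  have "S \<union> T = UP_set U (\<lambda>n. A n \<union> B n)"
    by (simp add: A(1) B(1) UP_set_Un[OF U])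
  then show "S \<union> T \<in> UP_algebra U M"
    unfolding UP_algebra_def using A(2) B(2)
    by (intro CollectI exI[of _ "\<lambda>n. A n \<union> B n"]) auto
qed

lemma measure_space_UP_sets:
  fixes M :: "'a measure"
  assumes U: "ultrafilter U" and M: "space M = UNIV"
  shows "measure_space (ultrapower U) (UP_sets U M)
           (outer_measure (UP_algebra U M) (UP_premeasure U M))"
proof -
  interpret algebra "ultrapower U" "UP_algebra U M"
    by (rule algebra_UP_algebra[OF assms])
  have nb: "U \<noteq> bot" using U by (simp add: ultrafilter_def)
  have e: "UP_set U (\<lambda>_. {} :: 'a set) = {}"
    using U by (auto simp: UP_set_def ultrafilter_def eventually_False)
  have "UP_premeasure U M {} = 0"
    using UP_premeasure_UP_set[OF U, of "\<lambda>_. {}" M]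
      tendsto_Lim[OF nb tendsto_const, of "0 :: ennreal"] e by simp
  then have pos: "positive (UP_algebra U M) (UP_premeasure U M)"
    by (simp add: positive_def)
  have inc: "increasing (UP_algebra U M) (UP_premeasure U M)"
    unfolding increasing_def
  proof (intro ballI impI)
    fix S T assume S: "S \<in> UP_algebra U M" and T: "T \<in> UP_algebra U M" and sub: "S \<subseteq> T"
    obtain A where A: "S = UP_set U A" "\<And>n. A n \<in> sets M"
      using S by (auto simp: UP_algebra_def)
    obtain B where B: "T = UP_set U B" "\<And>n. B n \<in> sets M"
      using T by (auto simp: UP_algebra_def)
    have "eventually (\<lambda>n. A n \<subseteq> B n) U"
      using sub A(1) B(1) by (simp flip: UP_set_mono_iff[OF U])
    then have "eventually (\<lambda>n. emeasure M (A n) \<le> emeasure M (B n)) U"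
      by (rule eventually_mono) (use B(2) in \<open>auto intro: emeasure_mono\<close>)
    then have "Lim U (\<lambda>n. emeasure M (A n)) \<le> Lim U (\<lambda>n. emeasure M (B n))"
      by (intro tendsto_le[OF nb tendsto_Lim_ultrafilter[OF U compact_UNIV]
            tendsto_Lim_ultrafilter[OF U compact_UNIV]])
    then show "UP_premeasure U M S \<le> UP_premeasure U M T"
      by (simp add: A(1) B(1) UP_premeasure_UP_set[OF U A(2)] UP_premeasure_UP_set[OF U B(2)])
  qed
  show ?thesis
    unfolding UP_sets_def
    by (rule sigma_algebra.caratheodory_lemma[OF sigma_algebra_Pow
          outer_measure_space_outer_measure[OF pos inc]])
qed

lemma
  assumes "ultrafilter U" and "space M = UNIV"
  shows space_UP_measure: "space (UP_measure U M) = ultrapower U"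
    and sets_UP_measure: "sets (UP_measure U M) = UP_sets U M"
    and emeasure_UP_measure: "S \<in> UP_sets U M \<Longrightarrow>
      emeasure (UP_measure U M) S = outer_measure (UP_algebra U M) (UP_premeasure U M) S"
proof -
  note ms = measure_space_UP_sets[OF assms, unfolded measure_space_def]
  have sa: "sigma_algebra (ultrapower U) (UP_sets U M)"
    and pos: "positive (UP_sets U M) (outer_measure (UP_algebra U M) (UP_premeasure U M))"
    and ca: "countably_additive (UP_sets U M) (outer_measure (UP_algebra U M) (UP_premeasure U M))"
    using ms by blast+
  have sub: "UP_sets U M \<subseteq> Pow (ultrapower U)"
    unfolding UP_sets_def by (auto dest: lambda_system_sets)
  show "space (UP_measure U M) = ultrapower U"
    unfolding UP_measure_def using sub by (rule space_measure_of)
  show "sets (UP_measure U M) = UP_sets U M"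
    unfolding UP_measure_def using sa by (rule sigma_algebra.sets_measure_of_eq)
  show "emeasure (UP_measure U M) S = outer_measure (UP_algebra U M) (UP_premeasure U M) S"
    if "S \<in> UP_sets U M"
    unfolding UP_measure_def
    by (rule emeasure_measure_of_sigma[OF sa pos ca that])
qed

end

theory Submission
  imports Defs
begin

text \<open>By \<open>\<aleph>\<^sub>1\<close>-saturation the premeasure is countably additive, so UP-sets keep their premeasure
  under the Caratheodory extension. For uniformly bounded sequences, step functions with
  levels in \<open>\<delta>\<nat>\<close> pass to the ultrapower level set by level set, and the integral formula holds up to
  \<open>\<delta>\<close>. The general case follows by truncation: a diagonal choice of levels shows that
  \<open>U\<close>-integrability forces the integrals of \<open>\<bar>f\<^sub>n\<bar>\<close> over \<open>{\<bar>f\<^sub>n\<bar> > K}\<close> to be small along \<open>U\<close>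
  for large \<open>K\<close>.\<close>

section \<open>Non-principal ultrafilters on the naturals and diagonal choice\<close>

lemma ultrafilter_not_eventually:
  "ultrafilter U \<Longrightarrow> \<not> eventually P U \<longleftrightarrow> eventually (\<lambda>i. \<not> P i) U"
proof
  assume U: "ultrafilter U" and "eventually (\<lambda>i. \<not> P i) U"
  show "\<not> eventually P U"
  proof
    assume "eventually P U"
    with \<open>eventually (\<lambda>i. \<not> P i) U\<close> have "eventually (\<lambda>i. False) U"
      by (rule eventually_elim2) simp
    then show False using U by (simp add: ultrafilter_def eventually_False)
  qed
qed (auto simp: ultrafilter_def)

text \<open>If \<open>{k}\<close> were \<open>U\<close>-large, then exactly the sets containing
  \<open>k\<close> would be \<open>U\<close>-large, which makes \<open>U\<close> principal.\<close>

lemma nonprincipal_ultrafilter_eventually_neq: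
  assumes "nonprincipal_ultrafilter U"
  shows "eventually (\<lambda>i. i \<noteq> k) U"
proof (rule ccontr)
  have U: "ultrafilter U" and np: "U \<noteq> principal {k}"
    using assms by (auto simp: nonprincipal_ultrafilter_def)
  assume "\<not> eventually (\<lambda>i. i \<noteq> k) U"
  then have k: "eventually (\<lambda>i. i = k) U"
    using ultrafilter_not_eventually[OF U, of "\<lambda>i. i \<noteq> k"] by simp
  have "eventually P U \<longleftrightarrow> P k" for P
  proof
    assume "P k"
    show "eventually P U" using k by (rule eventually_mono) (use \<open>P k\<close> in simp)
  next
    assume P: "eventually P U"
    show "P k"
    proof (rule ccontr)
      assume "\<not> P k"
      from k P have "eventually (\<lambda>i. False) U"
        by (rule eventually_elim2) (use \<open>\<not> P k\<close> in blast)
      then show False using U by (simp add: ultrafilter_def eventually_False)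
    qed
  qed
  then have "U = principal {k}"
    by (simp add: filter_eq_iff eventually_principal)
  with np show False ..
qed

lemma nonprincipal_ultrafilter_eventually_ge:
  fixes U :: "nat filter"
  assumes "nonprincipal_ultrafilter U"
  shows "eventually (\<lambda>n. k \<le> n) U"
proof -
  have "eventually (\<lambda>n. \<forall>i\<in>{..<k}. n \<noteq> i) U"
    by (rule eventually_ball_finite)
       (auto intro: nonprincipal_ultrafilter_eventually_neq[OF assms])
  then show ?thesis
    by (rule eventually_mono) (metis lessThan_iff not_le)
qed

text \<open>This merges countably many \<open>U\<close>-large conditions into one choice of index
  \<open>k n\<close> that tends to infinity along \<open>U\<close>. Both the saturation of UP-sets
  and the tail estimate for \<open>U\<close>-integrable sequences rest on it.\<close>

lemma nonprincipal_ultrafilter_diagonal: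
  fixes U :: "nat filter" and P :: "nat \<Rightarrow> nat \<Rightarrow> bool"
  assumes U: "nonprincipal_ultrafilter U"
    and P: "\<And>i. eventually (P i) U"
  obtains k where "\<And>i. eventually (\<lambda>n. i \<le> k n \<and> P (k n) n) U"
proof
  \<comment> \<open>The cap \<open>i \<le> n\<close> makes the greatest index exist, and
    non-principality makes it harmless: \<open>i \<le> n\<close> holds for \<open>U\<close>-many
    \<open>n\<close>. Where no index qualifies, \<open>k n\<close> is arbitrary, but the
    \<open>n\<close> in question form a \<open>U\<close>-small set because \<open>P 0\<close> holds
    along \<open>U\<close>.\<close>
  define k where "k n = (GREATEST i. i \<le> n \<and> P i n)" for n
  fix i
  from P[of i] nonprincipal_ultrafilter_eventually_ge[OF U, of i]
  show "eventually (\<lambda>n. i \<le> k n \<and> P (k n) n) U"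
  proof (rule eventually_elim2)
    fix n assume "P i n" "i \<le> n"
    then show "i \<le> k n \<and> P (k n) n"
      unfolding k_def
      using GreatestI_nat[of "\<lambda>i. i \<le> n \<and> P i n" i n] Greatest_le_nat[of "\<lambda>i. i \<le> n \<and> P i n" i n]
      by blast
  qed
qed

section \<open>Saturation of UP-sets\<close>

lemma UP_set_empty_iff:
  assumes "ultrafilter U"
  shows "UP_set U A = {} \<longleftrightarrow> eventually (\<lambda>n. A n = {}) U"
proof -
  have "UP_set U (\<lambda>_. {} :: 'a set) = {}"
    using assms by (auto simp: UP_set_def ultrafilter_def eventually_False)
  then show ?thesis
    using UP_set_mono_iff[OF assms, of A "\<lambda>_. {}"] by simp
qed

lemma UP_set_Int:
  assumes "ultrafilter U"
  shows "UP_set U A \<inter> UP_set U B = UP_set U (\<lambda>n. A n \<inter> B n)"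
  using UP_set_Diff[OF assms, of A "\<lambda>n. A n - B n"]
  by (simp add: Diff_Diff_Int flip: UP_set_Diff[OF assms])

text \<open>The diagonal choice supplies one level \<open>k n\<close> for each \<open>n\<close>,
  tending to infinity along \<open>U\<close>. A point of the \<open>k n\<close>-th finite
  intersection lies in \<open>B i n\<close> for all \<open>i \<le> k n\<close>, so the class of such
  points lies in every \<open>UP_set U (B i)\<close>.\<close>

lemma UP_set_saturation:
  fixes U :: "nat filter" and B :: "nat \<Rightarrow> nat \<Rightarrow> 'a set"
  assumes U: "nonprincipal_ultrafilter U"
    and dec: "decseq (\<lambda>i. UP_set U (B i))"
    and ne: "\<And>i. UP_set U (B i) \<noteq> {}"
  shows "(\<Inter>i. UP_set U (B i)) \<noteq> {}"
proof -
  have uf: "ultrafilter U" using U by (simp add: nonprincipal_ultrafilter_def)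
  \<comment> \<open>Monotonicity of the UP-sets gives \<open>B (Suc i) n \<subseteq> B i n\<close>
    only for \<open>U\<close>-many \<open>n\<close>, and which \<open>n\<close> these are depends on
    \<open>i\<close>. The finite intersections are nested at every \<open>n\<close> and represent
    the same UP-sets.\<close>
  define D where "D i n = (\<Inter>j\<le>i. B j n)" for i n
  have D_Suc: "D (Suc i) n = D i n \<inter> B (Suc i) n" for i n
    by (auto simp: D_def atMost_Suc)
  have UD: "UP_set U (D i) = UP_set U (B i)" for i
  proof (induction i)
    case 0
    show ?case by (simp add: D_def)
  next
    case (Suc i)
    have "UP_set U (D (Suc i)) = UP_set U (D i) \<inter> UP_set U (B (Suc i))"
      unfolding UP_set_Int[OF uf] D_Suc[abs_def] ..
    also have "\<dots> = UP_set U (B (Suc i))"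
      using Suc dec by (auto simp: decseq_Suc_iff)
    finally show ?case .
  qed
  have "eventually (\<lambda>n. D i n \<noteq> {}) U" for i
    using ne[of i] UP_set_empty_iff[OF uf, of "D i"] ultrafilter_not_eventually[OF uf]
    by (simp add: UD)
  then obtain k where k: "\<And>i. eventually (\<lambda>n. i \<le> k n \<and> D (k n) n \<noteq> {}) U"
    using nonprincipal_ultrafilter_diagonal[OF U, of "\<lambda>i n. D i n \<noteq> {}"] by blast
  define x where "x n = (SOME y. y \<in> D (k n) n)" for n
  have "uclass U x \<in> UP_set U (B i)" for i
    unfolding uclass_in_UP_set using k[of i]
  proof (rule eventually_mono)
    fix n assume "i \<le> k n \<and> D (k n) n \<noteq> {}"
    then have "x n \<in> D (k n) n" "i \<le> k n"
      by (auto simp: x_def some_in_eq)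
    then show "x n \<in> B i n" by (auto simp: D_def)
  qed
  then show ?thesis by blast
qed

section \<open>Approximation by step functions\<close>

text \<open>For finite \<open>t\<close> and \<open>d > 0\<close> this is
  \<open>d * min N (floor (t / d))\<close>. It is written as a sum of indicators of superlevel sets
  because those sets, taken along a sequence of functions, form UP-sets.\<close>

definition step_below :: "real \<Rightarrow> nat \<Rightarrow> ennreal \<Rightarrow> ennreal" where
  "step_below d N t = (\<Sum>j<N. ennreal d * indicator {ennreal (real (Suc j) * d)..} t)"

lemma step_below_le_level: "step_below d N t \<le> ennreal (real N * d)" if "0 \<le> d"
proof (induction N)
  case (Suc N)
  have "step_below d (Suc N) t \<le> step_below d N t + ennreal d"
    by (auto simp: step_below_def indicator_def)
  also have "\<dots> \<le> ennreal (real N * d) + ennreal d"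
    using Suc by (intro add_mono) auto
  also have "\<dots> = ennreal (real (Suc N) * d)"
    using that by (simp add: algebra_simps flip: ennreal_plus)
  finally show ?case .
qed (simp add: step_below_def)

lemma step_below_le: "step_below d N t \<le> t" if "0 \<le> d"
proof (induction N)
  case (Suc N)
  show ?case
  proof (cases "ennreal (real (Suc N) * d) \<le> t")
    case True
    then show ?thesis using step_below_le_level[OF that, of "Suc N" t] by (rule order_trans[rotated])
  next
    case False
    then have "step_below d (Suc N) t = step_below d N t"
      by (simp add: step_below_def)
    then show ?thesis using Suc by simp
  qed
qed (simp add: step_below_def)

lemma le_step_below: "t \<le> step_below d N t + ennreal d" if "0 \<le> d" "t \<le> ennreal (real N * d)"
  using that(2)
proof (induction N)
  case (Suc N)
  show ?case
  proof (cases "t \<le> ennreal (real N * d)")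
    case True
    have "step_below d N t \<le> step_below d (Suc N) t"
      by (simp add: step_below_def)
    with Suc.IH[OF True] show ?thesis
      by (meson add_right_mono order_trans)
  next
    \<comment> \<open>Here \<open>t\<close> lies above the first \<open>N\<close> levels, so all
      their indicators are 1 and the step value is exactly \<open>N * d\<close>.\<close>
    case False
    have "ennreal (real (Suc j) * d) \<le> t" if "j < N" for j
    proof -
      have "ennreal (real (Suc j) * d) \<le> ennreal (real N * d)"
        using that \<open>0 \<le> d\<close> by (intro ennreal_leI mult_right_mono) auto
      with False show ?thesis by simp
    qed
    then have "step_below d N t = (\<Sum>j<N. ennreal d)"
      unfolding step_below_def by (intro sum.cong) auto
    also have "\<dots> = ennreal (real N * d)"
      using \<open>0 \<le> d\<close> by (simp add: ennreal_mult ennreal_of_nat_eq_real_of_nat)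
    finally have *: "step_below d N t = ennreal (real N * d)" .
    have "t \<le> ennreal (real N * d) + ennreal d"
      using Suc.prems \<open>0 \<le> d\<close> by (simp add: algebra_simps flip: ennreal_plus)
    also have "\<dots> = step_below d N t + ennreal d"
      by (simp add: *)
    also have "\<dots> \<le> step_below d (Suc N) t + ennreal d"
      by (simp add: step_below_def)
    finally show ?thesis .
  qed
qed simp

section \<open>The ultrapower measure and its countable additivity\<close>

text \<open>The ultrapower consists of classes of sequences in the whole type, hence the assumption
  \<open>space_UNIV\<close>.\<close>

locale ultrapower_prob_space = prob_space M for M :: "'a measure" +
  fixes U :: "nat filter"
  assumes nonprincipal: "nonprincipal_ultrafilter U"
    and space_UNIV: "space M = UNIV"
begin

lemma ultra: "ultrafilter U"
  using nonprincipal by (simp add: nonprincipal_ultrafilter_def)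

lemma U_neq_bot: "U \<noteq> bot"
  using ultra by (simp add: ultrafilter_def)

lemma tendsto_UP_premeasure:
  assumes "\<And>n. A n \<in> sets M"
  shows "((\<lambda>n. emeasure M (A n)) \<longlongrightarrow> UP_premeasure U M (UP_set U A)) U"
  unfolding UP_premeasure_UP_set[OF ultra assms]
  by (rule tendsto_Lim_ultrafilter[OF ultra compact_UNIV])

lemma UP_set_in_UP_algebra: "(\<And>n. A n \<in> sets M) \<Longrightarrow> UP_set U A \<in> UP_algebra U M"
  by (auto simp: UP_algebra_def)

lemma UP_premeasure_empty: "UP_premeasure U M {} = 0"
proof -
  have "((\<lambda>n. emeasure M {}) \<longlongrightarrow> UP_premeasure U M (UP_set U (\<lambda>_. {}))) U"
    by (rule tendsto_UP_premeasure) simp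
  moreover have "UP_set U (\<lambda>_. {} :: 'a set) = {}"
    by (simp add: UP_set_empty_iff[OF ultra])
  ultimately show ?thesis
    by (simp add: tendsto_const_iff[OF U_neq_bot])
qed

lemma positive_UP_premeasure: "positive (UP_algebra U M) (UP_premeasure U M)"
  by (simp add: positive_def UP_premeasure_empty)

lemma additive_UP_premeasure: "additive (UP_algebra U M) (UP_premeasure U M)"
  unfolding additive_def
proof (intro ballI impI)
  fix S T assume "S \<in> UP_algebra U M" "T \<in> UP_algebra U M" and disj: "S \<inter> T = {}"
  then obtain A B where A: "S = UP_set U A" "\<And>n. A n \<in> sets M"
      and B: "T = UP_set U B" "\<And>n. B n \<in> sets M"
    unfolding UP_algebra_def by blast
  have "((\<lambda>n. emeasure M (A n) + emeasure M (B n)) \<longlongrightarrow> UP_premeasure U M S + UP_premeasure U M T) U"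
    unfolding A(1) B(1) by (intro tendsto_add tendsto_UP_premeasure A B)
  \<comment> \<open>Disjoint UP-sets have disjoint components only for \<open>U\<close>-many
    \<open>n\<close>, which is enough for the limits to agree.\<close>
  moreover have "eventually (\<lambda>n. A n \<inter> B n = {}) U"
    using disj by (simp add: A(1) B(1) UP_set_Int[OF ultra] UP_set_empty_iff[OF ultra])
  then have "eventually (\<lambda>n. emeasure M (A n) + emeasure M (B n) = emeasure M (A n \<union> B n)) U"
    by (rule eventually_mono) (intro plus_emeasure A B)
  ultimately have "((\<lambda>n. emeasure M (A n \<union> B n)) \<longlongrightarrow> UP_premeasure U M S + UP_premeasure U M T) U"
    by (rule Lim_transform_eventually)
  moreover have "((\<lambda>n. emeasure M (A n \<union> B n)) \<longlongrightarrow> UP_premeasure U M (S \<union> T)) U"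
    unfolding A(1) B(1) UP_set_Un[OF ultra] by (intro tendsto_UP_premeasure sets.Un A B)
  ultimately show "UP_premeasure U M (S \<union> T) = UP_premeasure U M S + UP_premeasure U M T"
    by (rule tendsto_unique[OF U_neq_bot, rotated])
qed

lemma UP_premeasure_le_1:
  assumes "S \<in> UP_algebra U M"
  shows "UP_premeasure U M S \<le> 1"
proof -
  obtain A where A: "S = UP_set U A" "\<And>n. A n \<in> sets M"
    using assms unfolding UP_algebra_def by blast
  show ?thesis
    unfolding A(1)
    by (rule tendsto_upperbound[OF tendsto_UP_premeasure[OF A(2)] _ U_neq_bot])
       (simp add: emeasure_le_1)
qed

text \<open>For a finite additive set function it suffices to check continuity at the empty set. By
  saturation, a decreasing sequence of UP-sets with empty intersection is empty from some index on,
  so its premeasures are eventually 0.\<close>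

lemma countably_additive_UP_premeasure:
  "countably_additive (UP_algebra U M) (UP_premeasure U M)"
proof -
  interpret algebra "ultrapower U" "UP_algebra U M"
    by (rule algebra_UP_algebra[OF ultra space_UNIV])
  show ?thesis
  proof (rule empty_continuous_imp_countably_additive[OF positive_UP_premeasure additive_UP_premeasure])
    show "\<forall>S\<in>UP_algebra U M. UP_premeasure U M S \<noteq> \<infinity>"
    proof
      fix S assume "S \<in> UP_algebra U M"
      from UP_premeasure_le_1[OF this] show "UP_premeasure U M S \<noteq> \<infinity>"
        by (auto simp: top_unique)
    qed
  next
    fix A :: "nat \<Rightarrow> (nat \<Rightarrow> 'a) set set"
    assume "range A \<subseteq> UP_algebra U M" and dec: "decseq A" and Int: "(\<Inter>i. A i) = {}"
    then have "\<forall>i. \<exists>B. A i = UP_set U B"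
      unfolding UP_algebra_def image_subset_iff by blast
    then obtain B where B: "\<And>i. A i = UP_set U (B i)"
      by metis
    obtain i where i: "A i = {}"
      using UP_set_saturation[OF nonprincipal, of B] dec Int by (auto simp flip: B)
    then have "A j = {}" if "i \<le> j" for j
      using dec that by (auto simp: decseq_def)
    then have "eventually (\<lambda>j. UP_premeasure U M (A j) = 0) sequentially"
      by (intro eventually_sequentiallyI[of i]) (simp add: UP_premeasure_empty)
    then show "(\<lambda>j. UP_premeasure U M (A j)) \<longlonglongrightarrow> 0"
      by (rule tendsto_eventually)
  qed
qed

abbreviation "L \<equiv> UP_measure U M"

lemma space_L: "space L = range (uclass U)"
  by (simp add: space_UP_measure[OF ultra space_UNIV] ultrapower_eq)

lemma UP_set_in_sets_L:
  assumes "\<And>n. A n \<in> sets M"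
  shows "UP_set U A \<in> sets L"
proof -
  interpret algebra "ultrapower U" "UP_algebra U M"
    by (rule algebra_UP_algebra[OF ultra space_UNIV])
  have "UP_algebra U M \<subseteq> UP_sets U M"
    unfolding UP_sets_def
    by (intro algebra_subset_lambda_system positive_UP_premeasure additive_UP_premeasure
        additive_increasing)
  then show ?thesis
    using UP_set_in_UP_algebra[of A] assms by (auto simp: sets_UP_measure[OF ultra space_UNIV])
qed

text \<open>Countable additivity of the premeasure enters here: it makes the outer measure agree
  with the premeasure on UP-sets, so the ultralimit formula carries over to
  \<open>L\<close>.\<close>

lemma tendsto_emeasure_L:
  assumes "\<And>n. A n \<in> sets M"
  shows "((\<lambda>n. emeasure M (A n)) \<longlongrightarrow> emeasure L (UP_set U A)) U"
proof -
  interpret algebra "ultrapower U" "UP_algebra U M"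
    by (rule algebra_UP_algebra[OF ultra space_UNIV])
  have "emeasure L (UP_set U A) = outer_measure (UP_algebra U M) (UP_premeasure U M) (UP_set U A)"
    using UP_set_in_sets_L[OF assms]
    by (intro emeasure_UP_measure[OF ultra space_UNIV]) (simp add: sets_UP_measure[OF ultra space_UNIV])
  also have "\<dots> = UP_premeasure U M (UP_set U A)"
    by (intro outer_measure_agrees positive_UP_premeasure countably_additive_UP_premeasure
        UP_set_in_UP_algebra assms)
  finally show ?thesis using tendsto_UP_premeasure[OF assms] by simp
qed

lemma prob_space_L: "prob_space L"
proof
  have *: "UP_set U (\<lambda>_. space M) = space L"
    by (auto simp: space_L UP_set_def space_UNIV)
  have "((\<lambda>n. emeasure M (space M)) \<longlongrightarrow> emeasure L (UP_set U (\<lambda>_. space M))) U"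
    by (rule tendsto_emeasure_L) simp
  then show "emeasure L (space L) = 1"
    unfolding * emeasure_space_1 by (simp add: tendsto_const_iff[OF U_neq_bot])
qed

section \<open>Measurability and integrals of ultralimits\<close>

text \<open>Each set \<open>{y < G}\<close> is a countable union of UP-sets, indexed by the
  \<open>q > y\<close> in a countable dense set. The gap between \<open>y\<close> and
  \<open>q\<close> matters: \<open>y < h n (x n)\<close> for \<open>U\<close>-many \<open>n\<close>
  yields only \<open>y \<le> G\<close>. The general value type covers both \<open>ennreal\<close>
  and \<open>ereal\<close>.\<close>

lemma borel_measurable_L:
  fixes h :: "nat \<Rightarrow> 'a \<Rightarrow> 'b::{linorder_topology, second_countable_topology, dense_linorder}"
  assumes h[measurable]: "\<And>n. h n \<in> borel_measurable M"
    and lim: "\<And>x. ((\<lambda>n. h n (x n)) \<longlongrightarrow> G (uclass U x)) U"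
  shows "G \<in> borel_measurable L"
proof (rule borel_measurableI_greater)
  fix y :: 'b
  obtain D :: "'b set" where D: "countable D" "\<And>X. open X \<Longrightarrow> X \<noteq> {} \<Longrightarrow> \<exists>d\<in>D. d \<in> X"
    by (rule countable_dense_setE) blast
  have "y < G (uclass U x) \<longleftrightarrow> (\<exists>q\<in>D. y < q \<and> eventually (\<lambda>n. q < h n (x n)) U)" for x
  proof
    assume "y < G (uclass U x)"
    then have "{y<..<G (uclass U x)} \<noteq> {}"
      using dense by auto
    then obtain q where "q \<in> D" "y < q" "q < G (uclass U x)"
      using D(2)[of "{y<..<G (uclass U x)}"] by auto
    then show "\<exists>q\<in>D. y < q \<and> eventually (\<lambda>n. q < h n (x n)) U"
      using order_tendstoD(1)[OF lim] by blast
  next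
    assume "\<exists>q\<in>D. y < q \<and> eventually (\<lambda>n. q < h n (x n)) U"
    then obtain q where q: "y < q" "eventually (\<lambda>n. q < h n (x n)) U" by blast
    have "q \<le> G (uclass U x)"
      by (rule tendsto_lowerbound[OF lim _ U_neq_bot])
         (use q(2) in \<open>auto elim: eventually_mono\<close>)
    with q(1) show "y < G (uclass U x)" by simp
  qed
  then have "{c \<in> space L. y < G c} = (\<Union>q\<in>D \<inter> {y<..}. UP_set U (\<lambda>n. {x \<in> space M. q < h n x}))"
    using UP_set_subset[of U] unfolding space_L ultrapower_eq
    by (fastforce simp: uclass_in_UP_set space_UNIV)
  also have "\<dots> \<in> sets L"
    using D(1) by (intro sets.countable_UN'' UP_set_in_sets_L) measurable
  finally show "{c \<in> space L. y < G c} \<in> sets L" .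
qed

text \<open>For step functions the claim is the limit formula for measures of UP-sets. The uniform
  bound lets finitely many levels of width \<open>d\<close> approximate every \<open>h n\<close>,
  and also \<open>G\<close>, from below within \<open>d\<close>. Both measures have mass 1, so the
  integrals are off by at most \<open>d\<close>.\<close>

lemma tendsto_nn_integral_bounded:
  fixes h :: "nat \<Rightarrow> 'a \<Rightarrow> ennreal"
  assumes h[measurable]: "\<And>n. h n \<in> borel_measurable M"
    and lim: "\<And>x. ((\<lambda>n. h n (x n)) \<longlongrightarrow> G (uclass U x)) U"
    and bd: "\<And>n x. h n x \<le> ennreal K"
  shows "((\<lambda>n. \<integral>\<^sup>+x. h n x \<partial>M) \<longlongrightarrow> (\<integral>\<^sup>+c. G c \<partial>L)) U"
proof -
  interpret L: prob_space L by (rule prob_space_L)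
  have [measurable]: "G \<in> borel_measurable L"
    using h lim by (rule borel_measurable_L)
  define l where "l = Lim U (\<lambda>n. \<integral>\<^sup>+x. h n x \<partial>M)"
  have l: "((\<lambda>n. \<integral>\<^sup>+x. h n x \<partial>M) \<longlongrightarrow> l) U"
    unfolding l_def by (rule tendsto_Lim_ultrafilter[OF ultra compact_UNIV])
  have *: "(\<integral>\<^sup>+c. G c \<partial>L) \<le> l + ennreal d \<and> l \<le> (\<integral>\<^sup>+c. G c \<partial>L) + ennreal d" if d: "0 < d" for d :: real
  proof -
    obtain N :: nat where "K < real N * d"
      using reals_Archimedean3[OF d] by blast
    then have N: "h n x \<le> ennreal (real N * d)" for n x
      using bd[of n x] by (meson ennreal_leI less_imp_le order_trans)
    define A where "A j n = {x \<in> space M. ennreal (real (Suc j) * d) \<le> h n x}" for j n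
    have A[measurable]: "A j n \<in> sets M" for j n
      unfolding A_def by measurable
    \<comment> \<open>\<open>S\<close> is the ultralimit of the step functions of the
      \<open>h n\<close>. It may differ from \<open>step_below d N (G c)\<close>: where
      \<open>h n (x n)\<close> tends to a level from below, \<open>G\<close> reaches that level but
      the class is not in the corresponding UP-set.\<close>
    define S where "S c = (\<Sum>j<N. ennreal d * indicator (UP_set U (A j)) c)" for c
    have [measurable]: "UP_set U (A j) \<in> sets L" for j
      by (rule UP_set_in_sets_L) (rule A)
    have S_lim: "((\<lambda>n. step_below d N (h n (x n))) \<longlongrightarrow> S (uclass U x)) U" for x
    proof (rule tendsto_eventually)
      \<comment> \<open>Indicators take two values, so along an ultrafilter each is constant on a
        \<open>U\<close>-large set. Only finitely many levels \<open>j\<close> occur, hence one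
        \<open>U\<close>-large set serves them all.\<close>
      have "eventually (\<lambda>n. indicator (A j n) (x n) = (indicator (UP_set U (A j)) (uclass U x) :: ennreal)) U" for j
      proof (cases "eventually (\<lambda>n. x n \<in> A j n) U")
        case True
        then show ?thesis
          by (rule eventually_mono) (simp add: uclass_in_UP_set True)
      next
        case False
        then have "eventually (\<lambda>n. x n \<notin> A j n) U"
          by (simp add: ultrafilter_not_eventually[OF ultra])
        then show ?thesis
          by (rule eventually_mono) (simp add: uclass_in_UP_set False)
      qed
      then have "eventually (\<lambda>n. \<forall>j\<in>{..<N}. indicator (A j n) (x n) = (indicator (UP_set U (A j)) (uclass U x) :: ennreal)) U"
        by (intro eventually_ball_finite) auto
      then show "eventually (\<lambda>n. step_below d N (h n (x n)) = S (uclass U x)) U"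
      proof (rule eventually_mono)
        fix n assume "\<forall>j\<in>{..<N}. indicator (A j n) (x n) = (indicator (UP_set U (A j)) (uclass U x) :: ennreal)"
        moreover have "indicator {ennreal (real (Suc j) * d)..} (h n (x n)) = (indicator (A j n) (x n) :: ennreal)" for j
          by (simp add: A_def space_UNIV indicator_def)
        ultimately show "step_below d N (h n (x n)) = S (uclass U x)"
          unfolding step_below_def S_def by (intro sum.cong) auto
      qed
    qed
    have S_le: "S c \<le> G c" and le_S: "G c \<le> S c + ennreal d" if "c \<in> space L" for c
    proof -
      from that obtain x where c: "c = uclass U x" by (auto simp: space_L)
      show "S c \<le> G c" unfolding c
        by (rule tendsto_le[OF U_neq_bot lim S_lim])
           (use \<open>0 < d\<close> in \<open>auto intro!: always_eventually step_below_le\<close>)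
      show "G c \<le> S c + ennreal d" unfolding c
        by (rule tendsto_le[OF U_neq_bot tendsto_add[OF S_lim tendsto_const] lim])
           (use \<open>0 < d\<close> N in \<open>auto intro!: always_eventually le_step_below\<close>)
    qed
    have int_step: "(\<integral>\<^sup>+x. step_below d N (h n x) \<partial>M) = (\<Sum>j<N. ennreal d * emeasure M (A j n))" for n
    proof -
      have "(\<integral>\<^sup>+x. step_below d N (h n x) \<partial>M) = (\<integral>\<^sup>+x. (\<Sum>j<N. ennreal d * indicator (A j n) x) \<partial>M)"
        unfolding step_below_def
        by (intro nn_integral_cong sum.cong) (auto simp: A_def indicator_def)
      also have "\<dots> = (\<Sum>j<N. ennreal d * emeasure M (A j n))"
        by (simp add: nn_integral_sum nn_integral_cmult del: sum_mult_indicator)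
      finally show ?thesis .
    qed
    have int_S: "(\<integral>\<^sup>+c. S c \<partial>L) = (\<Sum>j<N. ennreal d * emeasure L (UP_set U (A j)))"
      unfolding S_def by (simp add: nn_integral_sum nn_integral_cmult del: sum_mult_indicator)
    have S_tendsto: "((\<lambda>n. \<integral>\<^sup>+x. step_below d N (h n x) \<partial>M) \<longlongrightarrow> (\<integral>\<^sup>+c. S c \<partial>L)) U"
      unfolding int_step int_S
      by (intro tendsto_sum tendsto_mult_ennreal tendsto_const tendsto_emeasure_L A)
         (use \<open>0 < d\<close> L.emeasure_finite in auto)
    have [measurable]: "S \<in> borel_measurable L"
      unfolding S_def by measurable
    have sb[measurable]: "step_below d N \<in> borel_measurable borel"
      unfolding step_below_def by measurable
    have "(\<integral>\<^sup>+c. G c \<partial>L) \<le> (\<integral>\<^sup>+c. S c + ennreal d \<partial>L)"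
      by (intro nn_integral_mono le_S)
    also have "\<dots> = (\<integral>\<^sup>+c. S c \<partial>L) + ennreal d"
      by (simp add: nn_integral_add L.emeasure_space_1)
    also have "(\<integral>\<^sup>+c. S c \<partial>L) \<le> l"
      by (rule tendsto_le[OF U_neq_bot l S_tendsto])
         (use \<open>0 < d\<close> in \<open>auto intro!: always_eventually nn_integral_mono step_below_le\<close>)
    finally have 1: "(\<integral>\<^sup>+c. G c \<partial>L) \<le> l + ennreal d"
      by simp
    have "(\<integral>\<^sup>+x. h n x \<partial>M) \<le> (\<integral>\<^sup>+x. step_below d N (h n x) \<partial>M) + ennreal d" for n
    proof -
      have "(\<integral>\<^sup>+x. h n x \<partial>M) \<le> (\<integral>\<^sup>+x. step_below d N (h n x) + ennreal d \<partial>M)"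
        using \<open>0 < d\<close> N by (intro nn_integral_mono le_step_below) auto
      also have "\<dots> = (\<integral>\<^sup>+x. step_below d N (h n x) \<partial>M) + ennreal d"
        by (simp add: nn_integral_add emeasure_space_1)
      finally show ?thesis .
    qed
    then have "l \<le> (\<integral>\<^sup>+c. S c \<partial>L) + ennreal d"
      by (intro tendsto_le[OF U_neq_bot tendsto_add[OF S_tendsto tendsto_const] l] always_eventually) auto
    also have "(\<integral>\<^sup>+c. S c \<partial>L) \<le> (\<integral>\<^sup>+c. G c \<partial>L)"
      by (intro nn_integral_mono S_le)
    finally show ?thesis
      using 1 by simp
  qed
  have "(\<integral>\<^sup>+c. G c \<partial>L) = l"
    by (rule antisym; rule ennreal_le_epsilon) (use * in auto)
  with l show ?thesis by simp
qed

text \<open>Truncation at \<open>K\<close> reduces to the bounded case. Monotone convergence of the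
  truncations of \<open>G\<close> bounds its integral by \<open>l\<close>; conversely,
  \<open>tail\<close> prevents mass of the \<open>h n\<close> from escaping to infinity.\<close>

lemma tendsto_nn_integral:
  fixes h :: "nat \<Rightarrow> 'a \<Rightarrow> ennreal"
  assumes h[measurable]: "\<And>n. h n \<in> borel_measurable M"
    and lim: "\<And>x. ((\<lambda>n. h n (x n)) \<longlongrightarrow> G (uclass U x)) U"
    and tail: "\<And>e::real. 0 < e \<Longrightarrow>
      \<exists>K::nat. eventually (\<lambda>n. (\<integral>\<^sup>+x. h n x - of_nat K \<partial>M) \<le> ennreal e) U"
  shows "((\<lambda>n. \<integral>\<^sup>+x. h n x \<partial>M) \<longlongrightarrow> (\<integral>\<^sup>+c. G c \<partial>L)) U"
proof -
  have [measurable]: "G \<in> borel_measurable L"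
    using h lim by (rule borel_measurable_L)
  define l where "l = Lim U (\<lambda>n. \<integral>\<^sup>+x. h n x \<partial>M)"
  have l: "((\<lambda>n. \<integral>\<^sup>+x. h n x \<partial>M) \<longlongrightarrow> l) U"
    unfolding l_def by (rule tendsto_Lim_ultrafilter[OF ultra compact_UNIV])
  have trunc: "((\<lambda>n. \<integral>\<^sup>+x. min (h n x) (of_nat K) \<partial>M) \<longlongrightarrow> (\<integral>\<^sup>+c. min (G c) (of_nat K) \<partial>L)) U" for K :: nat
    by (rule tendsto_nn_integral_bounded[where K = "real K"])
       (auto intro!: tendsto_min lim simp: ennreal_of_nat_eq_real_of_nat)
  have "(\<integral>\<^sup>+c. G c \<partial>L) = (\<integral>\<^sup>+c. (SUP K. min (G c) (of_nat K)) \<partial>L)"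
    by (simp add: ennreal_SUP_of_nat_eq_top flip: inf_min inf_SUP)
  also have "\<dots> = (SUP K. \<integral>\<^sup>+c. min (G c) (of_nat K) \<partial>L)"
    by (intro nn_integral_monotone_convergence_SUP)
       (auto simp: incseq_def le_fun_def intro: min.coboundedI2)
  also have "\<dots> \<le> l"
  proof (rule SUP_least)
    fix K :: nat
    show "(\<integral>\<^sup>+c. min (G c) (of_nat K) \<partial>L) \<le> l"
      by (rule tendsto_le[OF U_neq_bot l trunc]) (auto intro!: always_eventually nn_integral_mono)
  qed
  finally have le: "(\<integral>\<^sup>+c. G c \<partial>L) \<le> l" .
  have "l \<le> (\<integral>\<^sup>+c. G c \<partial>L) + ennreal e" if e: "0 < e" for e :: real
  proof -
    obtain K :: nat where K: "eventually (\<lambda>n. (\<integral>\<^sup>+x. h n x - of_nat K \<partial>M) \<le> ennreal e) U"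
      using tail[OF e] by blast
    have "eventually (\<lambda>n. (\<integral>\<^sup>+x. h n x \<partial>M) \<le> (\<integral>\<^sup>+x. min (h n x) (of_nat K) \<partial>M) + ennreal e) U"
      using K
    proof (rule eventually_mono)
      fix n assume le_e: "(\<integral>\<^sup>+x. h n x - of_nat K \<partial>M) \<le> ennreal e"
      \<comment> \<open>Subtraction in \<open>ennreal\<close> is cut off at 0, so
        \<open>h n x - of_nat K\<close> is exactly the part removed by truncation.\<close>
      have "(\<integral>\<^sup>+x. h n x \<partial>M) = (\<integral>\<^sup>+x. min (h n x) (of_nat K) + (h n x - of_nat K) \<partial>M)"
        by (intro nn_integral_cong)
           (auto simp: min_def add_diff_inverse_ennreal diff_eq_0_iff_ennreal
             intro: order_le_less_trans[OF _ of_nat_less_top])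
      also have "\<dots> = (\<integral>\<^sup>+x. min (h n x) (of_nat K) \<partial>M) + (\<integral>\<^sup>+x. h n x - of_nat K \<partial>M)"
        by (rule nn_integral_add) auto
      finally show "(\<integral>\<^sup>+x. h n x \<partial>M) \<le> (\<integral>\<^sup>+x. min (h n x) (of_nat K) \<partial>M) + ennreal e"
        using le_e by (simp add: add_left_mono)
    qed
    then have "l \<le> (\<integral>\<^sup>+c. min (G c) (of_nat K) \<partial>L) + ennreal e"
      by (rule tendsto_le[OF U_neq_bot tendsto_add[OF trunc tendsto_const] l])
    also have "\<dots> \<le> (\<integral>\<^sup>+c. G c \<partial>L) + ennreal e"
      by (intro add_right_mono nn_integral_mono) auto
    finally show ?thesis .
  qed
  then have "l \<le> (\<integral>\<^sup>+c. G c \<partial>L)"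
    by (rule ennreal_le_epsilon)
  with le have "(\<integral>\<^sup>+c. G c \<partial>L) = l" by (rule antisym)
  with l show ?thesis by simp
qed

section \<open>Uniform integrability along the ultrafilter\<close>

text \<open>If every level \<open>K\<close> failed, the diagonal choice would give levels
  \<open>k n\<close> tending to infinity along \<open>U\<close> whose tail integrals still exceed
  \<open>e\<close> for \<open>U\<close>-many \<open>n\<close>. The integrals of
  \<open>\<bar>f n\<bar>\<close> are bounded along \<open>U\<close>, so by Markov's inequality the
  sets \<open>{\<bar>f n\<bar> > k n}\<close> have measure tending to 0, and the third condition of
  \<open>U\<close>-integrability is violated.\<close>

lemma U_integrable_tail:
  assumes f: "U_integrable U M f" and e: "0 < e"
  shows "\<exists>K::nat. eventually
    (\<lambda>n. set_lebesgue_integral M {x. real K < \<bar>f n x\<bar>} (\<lambda>x. \<bar>f n x\<bar>) \<le> e) U"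
proof (rule ccontr)
  have [measurable]: "\<And>n. f n \<in> borel_measurable M" and int: "\<And>n. integrable M (f n)"
    and fin: "\<bar>ulim U (\<lambda>n. \<integral>x. \<bar>f n x\<bar> \<partial>M)\<bar> \<noteq> \<infinity>"
    and small: "\<And>B. (\<And>n. B n \<in> sets M) \<Longrightarrow> ulim U (\<lambda>n. measure M (B n)) = 0 \<Longrightarrow>
        ulim U (\<lambda>n. set_lebesgue_integral M (B n) (\<lambda>x. \<bar>f n x\<bar>)) = 0"
    using f by (auto simp: U_integrable_def)
  define B where "B k n = {x \<in> space M. real k < \<bar>f n x\<bar>}" for k n
  have B[measurable]: "B k n \<in> sets M" for k n
    unfolding B_def by measurable
  define I where "I k n = set_lebesgue_integral M (B k n) (\<lambda>x. \<bar>f n x\<bar>)" for k n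
  assume "\<nexists>K::nat. eventually
    (\<lambda>n. set_lebesgue_integral M {x. real K < \<bar>f n x\<bar>} (\<lambda>x. \<bar>f n x\<bar>) \<le> e) U"
  then have "eventually (\<lambda>n. e < I k n) U" for k
    unfolding I_def B_def space_UNIV by (simp add: ultrafilter_not_eventually[OF ultra] not_le)
  then obtain k where k: "\<And>i. eventually (\<lambda>n. i \<le> k n \<and> e < I (k n) n) U"
    using nonprincipal_ultrafilter_diagonal[OF nonprincipal, of "\<lambda>k n. e < I k n"] by blast
  obtain C where C: "ulim U (\<lambda>n. \<integral>x. \<bar>f n x\<bar> \<partial>M) = ereal C"
    using fin by auto
  have "((\<lambda>n. ereal (\<integral>x. \<bar>f n x\<bar> \<partial>M)) \<longlongrightarrow> ereal C) U"
    unfolding C[symmetric] by (rule tendsto_Lim_ultrafilter[OF ultra compact_UNIV])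
  then have "eventually (\<lambda>n. ereal (\<integral>x. \<bar>f n x\<bar> \<partial>M) < ereal (C + 1)) U"
    by (rule order_tendstoD) simp
  then have C': "eventually (\<lambda>n. (\<integral>x. \<bar>f n x\<bar> \<partial>M) < C + 1) U"
    by simp
  have "((\<lambda>n. measure M (B (k n) n)) \<longlongrightarrow> 0) U"
  proof (rule tendstoI)
    fix d :: real assume d: "0 < d"
    obtain i :: nat where i: "(C + 1) / d < real i"
      using reals_Archimedean2 by blast
    show "eventually (\<lambda>n. dist (measure M (B (k n) n)) 0 < d) U"
      \<comment> \<open>\<open>Suc i\<close> in place of \<open>i\<close> makes \<open>k n\<close>
        positive, as the division in Markov's inequality requires.\<close>
      using C' k[of "Suc i"]
    proof (rule eventually_elim2)
      fix n assume c: "(\<integral>x. \<bar>f n x\<bar> \<partial>M) < C + 1" and k: "Suc i \<le> k n \<and> e < I (k n) n"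
      have pos: "0 < real (k n)" using k by simp
      have "measure M (B (k n) n) \<le> measure M {x \<in> space M. real (k n) \<le> \<bar>f n x\<bar>}"
        by (intro finite_measure_mono) (auto simp: B_def)
      also have "\<dots> \<le> (\<integral>x. \<bar>f n x\<bar> \<partial>M) / real (k n)"
        using pos int by (intro integral_Markov_inequality_measure[where A = "{}"]) auto
      also have "\<dots> < d"
      proof -
        have "C + 1 < real i * d" using i d by (simp add: field_simps)
        also have "\<dots> \<le> real (k n) * d" using k d by (intro mult_right_mono) auto
        finally show ?thesis using c pos by (simp add: field_simps)
      qed
      finally show "dist (measure M (B (k n) n)) 0 < d" by simp
    qed
  qed
  then have "((\<lambda>n. ereal (measure M (B (k n) n))) \<longlongrightarrow> 0) U"
    by (simp add: zero_ereal_def)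
  then have "ulim U (\<lambda>n. measure M (B (k n) n)) = 0"
    by (rule tendsto_Lim[OF U_neq_bot])
  then have "ulim U (\<lambda>n. I (k n) n) = 0"
    unfolding I_def by (intro small B)
  then have "((\<lambda>n. ereal (I (k n) n)) \<longlongrightarrow> 0) U"
    using tendsto_Lim_ultrafilter[OF ultra compact_UNIV, of "\<lambda>n. ereal (I (k n) n)"] by simp
  then have "eventually (\<lambda>n. ereal (I (k n) n) < ereal e) U"
    using e by (intro order_tendstoD) auto
  then have "eventually (\<lambda>n. False) U"
    using k[of 0] by (rule eventually_elim2) simp
  then show False
    using U_neq_bot by (simp add: eventually_False)
qed

text \<open>The excess of \<open>h n\<close> over \<open>K\<close> vanishes where
  \<open>\<bar>f n\<bar> \<le> K\<close> and is at most \<open>\<bar>f n\<bar>\<close> elsewhere, so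
  the tail estimate for \<open>f\<close> applies. Domination by \<open>\<bar>f n\<bar>\<close> lets
  one lemma handle the absolute value and both the positive and the negative part.\<close>

lemma tendsto_nn_integral_U_integrable:
  fixes h :: "nat \<Rightarrow> 'a \<Rightarrow> ennreal"
  assumes f: "U_integrable U M f"
    and h[measurable]: "\<And>n. h n \<in> borel_measurable M"
    and lim: "\<And>x. ((\<lambda>n. h n (x n)) \<longlongrightarrow> G (uclass U x)) U"
    and le: "\<And>n x. h n x \<le> ennreal \<bar>f n x\<bar>"
  shows "((\<lambda>n. \<integral>\<^sup>+x. h n x \<partial>M) \<longlongrightarrow> (\<integral>\<^sup>+c. G c \<partial>L)) U"
proof (rule tendsto_nn_integral[OF h lim])
  have [measurable]: "\<And>n. f n \<in> borel_measurable M" and int: "\<And>n. integrable M (f n)"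
    using f by (auto simp: U_integrable_def)
  fix e :: real assume "0 < e"
  then obtain K :: nat where K: "eventually
      (\<lambda>n. set_lebesgue_integral M {x. real K < \<bar>f n x\<bar>} (\<lambda>x. \<bar>f n x\<bar>) \<le> e) U"
    using U_integrable_tail[OF f] by blast
  have "(\<integral>\<^sup>+x. h n x - of_nat K \<partial>M)
      \<le> ennreal (set_lebesgue_integral M {x. real K < \<bar>f n x\<bar>} (\<lambda>x. \<bar>f n x\<bar>))" for n
  proof -
    define B where "B = {x \<in> space M. real K < \<bar>f n x\<bar>}"
    have B[measurable]: "B \<in> sets M" unfolding B_def by measurable
    have "(\<integral>\<^sup>+x. h n x - of_nat K \<partial>M) \<le> (\<integral>\<^sup>+x. ennreal (indicator B x *\<^sub>R \<bar>f n x\<bar>) \<partial>M)"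
    proof (rule nn_integral_mono)
      fix x assume x: "x \<in> space M"
      have 1: "h n x - of_nat K \<le> h n x"
        by (simp add: diff_le_self_ennreal)
      have 2: "h n x - of_nat K = 0" if "\<bar>f n x\<bar> \<le> real K"
      proof -
        have "h n x \<le> ennreal (real K)"
          using le[of n x] ennreal_leI[OF that] by (rule order_trans)
        moreover from this have "h n x < top"
          by (rule order_le_less_trans) simp
        ultimately show ?thesis
          by (simp add: diff_eq_0_iff_ennreal ennreal_of_nat_eq_real_of_nat)
      qed
      show "h n x - of_nat K \<le> ennreal (indicator B x *\<^sub>R \<bar>f n x\<bar>)"
        using order_trans[OF 1 le] 2 x by (cases "x \<in> B") (auto simp: B_def)
    qed
    also have "\<dots> = ennreal (\<integral>x. indicator B x *\<^sub>R \<bar>f n x\<bar> \<partial>M)"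
      using int by (intro nn_integral_eq_integral integrable_mult_indicator) auto
    finally show ?thesis
      by (simp add: set_lebesgue_integral_def B_def space_UNIV)
  qed
  then have "eventually (\<lambda>n. (\<integral>\<^sup>+x. h n x - of_nat K \<partial>M) \<le> ennreal e) U"
    using K by (auto elim!: eventually_mono intro: order_trans ennreal_leI)
  then show "\<exists>K::nat. eventually (\<lambda>n. (\<integral>\<^sup>+x. h n x - of_nat K \<partial>M) \<le> ennreal e) U" ..
qed

end

section \<open>The integral formula for signed functions\<close>

theorem theorem2:
  fixes U :: "nat filter"
    and M :: "'a::metric_space measure"
    and f :: "nat \<Rightarrow> 'a \<Rightarrow> real"
  assumes "compact (UNIV :: 'a set)"
    and "sets M = sets borel"
    and "prob_space M"
    and "nonprincipal_ultrafilter U"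
    and "U_integrable U M f"
  shows "ereal_integrable (UP_measure U M) (ulim_fun U f) \<and>
    ereal_integral (UP_measure U M) (ulim_fun U f) = ulim U (\<lambda>n. \<integral>x. f n x \<partial>M)"
proof -
  interpret prob_space M by fact
  interpret ultrapower_prob_space M U
    using assms(4) sets_eq_imp_space_eq[OF assms(2)] by unfold_locales auto
  have meas[measurable]: "\<And>n. f n \<in> borel_measurable M" and int: "\<And>n. integrable M (f n)"
    and fin: "\<bar>ulim U (\<lambda>n. \<integral>x. \<bar>f n x\<bar> \<partial>M)\<bar> \<noteq> \<infinity>"
    using assms(5) by (auto simp: U_integrable_def)
  let ?G = "ulim_fun U f"
  have lim: "((\<lambda>n. ereal (f n (x n))) \<longlongrightarrow> ?G (uclass U x)) U" for x
    unfolding ulim_fun_uclass by (rule tendsto_Lim_ultrafilter[OF ultra compact_UNIV])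
  have [measurable]: "?G \<in> borel_measurable L"
    using lim by (rule borel_measurable_L[rotated]) measurable
  note U_int = tendsto_nn_integral_U_integrable[OF assms(5)]
  have abs_lim: "((\<lambda>n. \<integral>\<^sup>+x. ennreal \<bar>f n x\<bar> \<partial>M) \<longlongrightarrow> (\<integral>\<^sup>+c. e2ennreal \<bar>?G c\<bar> \<partial>L)) U"
  proof (rule U_int)
    fix x
    show "((\<lambda>n. ennreal \<bar>f n (x n)\<bar>) \<longlongrightarrow> e2ennreal \<bar>?G (uclass U x)\<bar>) U"
      using tendsto_e2ennrealI[OF tendsto_abs_ereal[OF lim]] by simp
  qed auto
  have pos_lim: "((\<lambda>n. \<integral>\<^sup>+x. ennreal (f n x) \<partial>M) \<longlongrightarrow> (\<integral>\<^sup>+c. e2ennreal (?G c) \<partial>L)) U"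
  proof (rule U_int)
    fix x
    show "((\<lambda>n. ennreal (f n (x n))) \<longlongrightarrow> e2ennreal (?G (uclass U x))) U"
      using tendsto_e2ennrealI[OF lim] by simp
  qed (auto intro: ennreal_leI)
  have neg_lim: "((\<lambda>n. \<integral>\<^sup>+x. ennreal (- f n x) \<partial>M) \<longlongrightarrow> (\<integral>\<^sup>+c. e2ennreal (- ?G c) \<partial>L)) U"
  proof (rule U_int)
    fix x
    show "((\<lambda>n. ennreal (- f n (x n))) \<longlongrightarrow> e2ennreal (- ?G (uclass U x))) U"
      using tendsto_e2ennrealI[OF tendsto_uminus_ereal[OF lim]] by simp
  qed (auto intro: ennreal_leI)
  \<comment> \<open>Comparing this limit with \<open>abs_lim\<close> identifies the integral of the
    absolute value of the ultralimit with the ultralimit of the integrals of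
    \<open>\<bar>f n\<bar>\<close>, which is finite by \<open>U\<close>-integrability.\<close>
  have "((\<lambda>n. e2ennreal (ereal (\<integral>x. \<bar>f n x\<bar> \<partial>M))) \<longlongrightarrow> e2ennreal (ulim U (\<lambda>n. \<integral>x. \<bar>f n x\<bar> \<partial>M))) U"
    by (intro tendsto_e2ennrealI tendsto_Lim_ultrafilter[OF ultra compact_UNIV])
  then have "((\<lambda>n. \<integral>\<^sup>+x. ennreal \<bar>f n x\<bar> \<partial>M) \<longlongrightarrow> e2ennreal (ulim U (\<lambda>n. \<integral>x. \<bar>f n x\<bar> \<partial>M))) U"
    using int by (subst nn_integral_eq_integral) auto
  then have "(\<integral>\<^sup>+c. e2ennreal \<bar>?G c\<bar> \<partial>L) = e2ennreal (ulim U (\<lambda>n. \<integral>x. \<bar>f n x\<bar> \<partial>M))"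
    by (rule tendsto_unique[OF U_neq_bot abs_lim])
  also have "\<dots> < \<infinity>"
    using fin by (cases "ulim U (\<lambda>n. \<integral>x. \<bar>f n x\<bar> \<partial>M)") auto
  finally have fin_abs: "(\<integral>\<^sup>+c. e2ennreal \<bar>?G c\<bar> \<partial>L) < \<infinity>" .
  have abs_ge: "z \<le> \<bar>z\<bar>" for z :: ereal
    by (cases z) auto
  have "(\<integral>\<^sup>+c. e2ennreal (?G c) \<partial>L) \<le> (\<integral>\<^sup>+c. e2ennreal \<bar>?G c\<bar> \<partial>L)"
    by (intro nn_integral_mono e2ennreal_mono abs_ge)
  then have fin_pos: "(\<integral>\<^sup>+c. e2ennreal (?G c) \<partial>L) < \<infinity>"
    using fin_abs by (rule order_le_less_trans)
  have "(\<integral>\<^sup>+c. e2ennreal (- ?G c) \<partial>L) \<le> (\<integral>\<^sup>+c. e2ennreal \<bar>?G c\<bar> \<partial>L)"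
    by (intro nn_integral_mono e2ennreal_mono) (metis abs_ge abs_ereal_uminus)
  then have fin_neg: "(\<integral>\<^sup>+c. e2ennreal (- ?G c) \<partial>L) < \<infinity>"
    using fin_abs by (rule order_le_less_trans)
  have *: "enn2ereal (\<integral>\<^sup>+x. ennreal (f n x) \<partial>M) - enn2ereal (\<integral>\<^sup>+x. ennreal (- f n x) \<partial>M)
      = ereal (\<integral>x. f n x \<partial>M)" for n
  proof -
    have "(\<integral>\<^sup>+x. ennreal (f n x) \<partial>M) \<noteq> \<infinity>" "(\<integral>\<^sup>+x. ennreal (- f n x) \<partial>M) \<noteq> \<infinity>"
      using int[of n] by (auto simp: real_integrable_def)
    then show ?thesis
      unfolding real_lebesgue_integral_def[OF int]
      by (cases "\<integral>\<^sup>+x. ennreal (f n x) \<partial>M" rule: ennreal_cases;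
          cases "\<integral>\<^sup>+x. ennreal (- f n x) \<partial>M" rule: ennreal_cases) (auto simp: enn2ereal_ennreal)
  qed
  have abs_fin: "\<bar>enn2ereal z\<bar> \<noteq> \<infinity>" if "z < \<infinity>" for z
    using that by (cases z rule: ennreal_cases) (auto simp: enn2ereal_ennreal)
  \<comment> \<open>Subtraction on \<open>ereal\<close> is continuous at pairs of finite values,
    which \<open>fin_pos\<close> and \<open>fin_neg\<close> guarantee for the limits of the two
    parts.\<close>
  have "((\<lambda>n. ereal (\<integral>x. f n x \<partial>M)) \<longlongrightarrow> ereal_integral L ?G) U"
    unfolding ereal_integral_def *[symmetric]
    by (intro tendsto_diff_ereal tendsto_enn2erealI pos_lim neg_lim abs_fin fin_pos fin_neg)
  then have "ulim U (\<lambda>n. \<integral>x. f n x \<partial>M) = ereal_integral L ?G"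
    by (rule tendsto_Lim[OF U_neq_bot])
  then show ?thesis
    using fin_abs by (simp add: ereal_integrable_def)
qed

end
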